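(* Let $(W,S)$ be a Coxeter system, let $\underline{s}=(s_1,\ldots,s_n)$ be a finite sequence of elements of $S$ and let $w\in W$. Then the graph $\mathfrak{S}(\underline{s},w)$ is connected.
   Context: A subexpression of $\underline{s}=(s_1,\ldots,s_n)$ with target $w$ is a sequence $(\epsilon_1,\ldots,\epsilon_n)$ with entries in $\{0,1\}$ such that $s_1^{\epsilon_1}s_2^{\epsilon_2}\cdots s_n^{\epsilon_n}=w$. The subexpression graph $\mathfrak{S}(\underline{s},w)$ is the undirected graph whose vertices are all subexpressions of $\underline{s}$ with target $w$ and whose edges are the pairs of vertices at Hamming distance exactly $2$ (i.e. differing in exactly two positions). Convention: the graph with empty vertex set counts as connected; equivalently, the claim is that any two vertices are joined by a path. *)

theory Defs
  imports
    "HOL-Algebra.Generated_Groups"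
    "HOL-Library.Extended_Nat"
    "Graph_Theory.Digraph_Component"
begin

section \<open>Group presentations\<close>

text \<open>A word is a list of letters \<open>(s, b)\<close>, where \<open>(s, True)\<close> stands for the generator \<open>s\<close>
  and \<open>(s, False)\<close> for its formal inverse.\<close>

type_synonym 'a gword = "('a \<times> bool) list"

abbreviation words_over :: "'a set \<Rightarrow> 'a gword set" where
  "words_over S \<equiv> lists (S \<times> UNIV)"

text \<open>Equality of words in the group presented by generators \<open>S\<close> and relators \<open>R\<close>: the
  congruence generated by free cancellation and by \<open>r = 1\<close> for all \<open>r \<in> R\<close>.\<close>

inductive pres_eq :: "'a set \<Rightarrow> 'a gword set \<Rightarrow> 'a gword \<Rightarrow> 'a gword \<Rightarrow> bool" for S R where
  refl: "u \<in> words_over S \<Longrightarrow> pres_eq S R u u"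
| sym: "pres_eq S R u v \<Longrightarrow> pres_eq S R v u"
| trans: "pres_eq S R u v \<Longrightarrow> pres_eq S R v x \<Longrightarrow> pres_eq S R u x"
| append: "pres_eq S R u u' \<Longrightarrow> pres_eq S R v v' \<Longrightarrow> pres_eq S R (u @ v) (u' @ v')"
| cancel: "s \<in> S \<Longrightarrow> pres_eq S R [(s, b), (s, \<not> b)] []"
| relator: "r \<in> R \<Longrightarrow> pres_eq S R r []"

definition list_mult :: "('a, 'm) monoid_scheme \<Rightarrow> 'a list \<Rightarrow> 'a" where
  "list_mult G xs = foldr (\<lambda>x y. x \<otimes>\<^bsub>G\<^esub> y) xs \<one>\<^bsub>G\<^esub>"

definition word_eval :: "('a, 'm) monoid_scheme \<Rightarrow> 'a gword \<Rightarrow> 'a" where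
  "word_eval G u = list_mult G (map (\<lambda>(s, b). if b then s else inv\<^bsub>G\<^esub> s) u)"

text \<open>The canonical homomorphism from \<open>\<langle>S | R\<rangle>\<close> to \<open>G\<close> is well defined and bijective.\<close>

definition presented_by :: "('a, 'm) monoid_scheme \<Rightarrow> 'a set \<Rightarrow> 'a gword set \<Rightarrow> bool" where
  "presented_by G S R \<longleftrightarrow>
     group G \<and> S \<subseteq> carrier G \<and> R \<subseteq> words_over S \<and> generate G S = carrier G \<and>
     (\<forall>u\<in>words_over S. \<forall>v\<in>words_over S. word_eval G u = word_eval G v \<longleftrightarrow> pres_eq S R u v)"


section \<open>Coxeter systems\<close>

definition coxeter_matrix :: "'a set \<Rightarrow> ('a \<Rightarrow> 'a \<Rightarrow> enat) \<Rightarrow> bool" where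
  "coxeter_matrix S m \<longleftrightarrow>
     (\<forall>s\<in>S. m s s = 1) \<and>
     (\<forall>s\<in>S. \<forall>t\<in>S. m s t = m t s) \<and>
     (\<forall>s\<in>S. \<forall>t\<in>S. s \<noteq> t \<longrightarrow> 2 \<le> m s t)"

text \<open>The relators \<open>(s t)\<^sup>m\<close> with \<open>m = m(s,t)\<close>; there is none for \<open>m(s,t) = \<infinity>\<close>,
  and \<open>s = t\<close> gives \<open>s\<^sup>2\<close>.\<close>

definition coxeter_relators :: "'a set \<Rightarrow> ('a \<Rightarrow> 'a \<Rightarrow> enat) \<Rightarrow> 'a gword set" where
  "coxeter_relators S m =
     {concat (replicate k [(s, True), (t, True)]) | s t k. s \<in> S \<and> t \<in> S \<and> m s t = enat k}"

definition coxeter_system :: "('a, 'm) monoid_scheme \<Rightarrow> 'a set \<Rightarrow> bool" where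
  "coxeter_system W S \<longleftrightarrow>
     (\<exists>m. coxeter_matrix S m \<and> presented_by W S (coxeter_relators S m))"


section \<open>The subexpression graph\<close>

definition subexpressions :: "('a, 'm) monoid_scheme \<Rightarrow> 'a list \<Rightarrow> 'a \<Rightarrow> nat list set" where
  "subexpressions W ss w =
     {e. length e = length ss \<and> set e \<subseteq> {0, 1} \<and>
         list_mult W (map2 (\<lambda>s k. s [^]\<^bsub>W\<^esub> k) ss e) = w}"

text \<open>Used only for lists of equal length.\<close>

definition hamming_dist :: "'b list \<Rightarrow> 'b list \<Rightarrow> nat" where
  "hamming_dist e f = card {i. i < length e \<and> e ! i \<noteq> f ! i}"

text \<open>As usual in \<^theory>\<open>Graph_Theory.Digraph\<close>, an undirected graph is a symmetric digraph.\<close>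

definition subexpression_graph ::
    "('a, 'm) monoid_scheme \<Rightarrow> 'a list \<Rightarrow> 'a \<Rightarrow> nat list pair_pre_digraph" where
  "subexpression_graph W ss w =
     \<lparr> pverts = subexpressions W ss w,
       parcs = {(e, f). e \<in> subexpressions W ss w \<and> f \<in> subexpressions W ss w \<and>
                        hamming_dist e f = 2} \<rparr>"

lemma finite_subexpressions: "finite (subexpressions W ss w)"
  by (rule finite_subset[OF _ finite_lists_length_eq[of "{0, 1}" "length ss"]])
    (auto simp: subexpressions_def)

lemma pair_graph_subexpression_graph: "pair_graph (subexpression_graph W ss w)"
proof
  show "finite (parcs (subexpression_graph W ss w))"
    by (rule finite_subset[of _ "subexpressions W ss w \<times> subexpressions W ss w"])
      (auto simp: subexpression_graph_def finite_subexpressions)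
  have "hamming_dist e f = hamming_dist f e"
    if "e \<in> subexpressions W ss w" "f \<in> subexpressions W ss w" for e f
    using that by (auto simp: hamming_dist_def subexpressions_def eq_commute)
  then show "symmetric (subexpression_graph W ss w)"
    by (auto simp: symmetric_def subexpression_graph_def arcs_ends_conv intro!: symI)
qed (auto simp: subexpression_graph_def finite_subexpressions hamming_dist_def)

end

theory Submission
  imports Defs
begin

text \<open>Induct on the length of the sequence. The subexpressions of \<open>s # ss\<close> with target \<open>w\<close> split
  by their first entry into a copy of the subexpressions of \<open>ss\<close> with target \<open>w\<close> and a copy of
  those with target \<open>s w\<close>, and both copies are connected by induction. If neither is empty, it
  remains to find one edge between them, that is, two subexpressions of \<open>ss\<close> at Hamming distance
  1 whose targets are \<open>w\<close> and \<open>s w\<close> (\<open>subexpressions_adjacent_targets\<close>).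

  This edge comes from an exchange property (\<open>subexpression_exchange\<close>). A word
  \<open>x\<^sub>1 \<dots> x\<^sub>k\<close> in the generators has the inversions
  \<open>x\<^sub>1 \<dots> x\<^sub>i \<dots> x\<^sub>1\<close>; multiplying the product by the \<open>i\<close>-th inversion on the left
  amounts to deleting the letter \<open>x\<^sub>i\<close>. So if \<open>s\<close> is an inversion of the
  word chosen by a subexpression with target \<open>w\<close>, changing one entry from 1 to 0 gives target
  \<open>s w\<close>. The words in question need not be reduced, so the length function is replaced by
  the parity of the number of occurrences of \<open>s\<close> among the inversions. In a Coxeter group this
  parity depends only on the product of the word (\<open>odd_inversion_cong\<close>), because every defining
  relator contains each inversion an even number of times. Prefixing a word by \<open>s\<close> flips
  the parity for \<open>s\<close>, so of the two targets \<open>w\<close> and \<open>s w\<close> one has odd parity, and every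
  subexpression with that target can be changed in one entry to reach the other.\<close>

section \<open>The parity of inversions of a word\<close>

text \<open>The parity of the number of \<open>i\<close> with
  \<open>t = (x\<^sub>1 \<dots> x\<^sub>i\<^sub>-\<^sub>1) x\<^sub>i (x\<^sub>1 \<dots> x\<^sub>i\<^sub>-\<^sub>1)\<inverse>\<close>. Recursion on the first letter conjugates the
  tested element instead of the inversions.\<close>

fun odd_inversion :: "('a, 'm) monoid_scheme \<Rightarrow> 'a list \<Rightarrow> 'a \<Rightarrow> bool" where
  "odd_inversion G [] t \<longleftrightarrow> False"
| "odd_inversion G (s # xs) t \<longleftrightarrow> (t = s) \<noteq> odd_inversion G xs (inv\<^bsub>G\<^esub> s \<otimes>\<^bsub>G\<^esub> t \<otimes>\<^bsub>G\<^esub> s)"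

lemma list_mult_Nil [simp]: "list_mult G [] = \<one>\<^bsub>G\<^esub>"
  and list_mult_Cons [simp]: "list_mult G (x # xs) = x \<otimes>\<^bsub>G\<^esub> list_mult G xs"
  by (simp_all add: list_mult_def)

context group
begin

lemma list_mult_closed [simp, intro]: "set xs \<subseteq> carrier G \<Longrightarrow> list_mult G xs \<in> carrier G"
  by (induction xs) auto

text \<open>This cocycle identity reduces invariance under the congruence \<^const>\<open>pres_eq\<close> to invariance
  under its generating pairs.\<close>

lemma odd_inversion_append:
  assumes "set xs \<subseteq> carrier G" "set ys \<subseteq> carrier G" "t \<in> carrier G"
  shows "odd_inversion G (xs @ ys) t \<longleftrightarrow>
    odd_inversion G xs t \<noteq> odd_inversion G ys (inv (list_mult G xs) \<otimes> t \<otimes> list_mult G xs)"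
  using assms by (induction xs arbitrary: t) (auto simp: inv_mult_group m_assoc)

lemma conjugate_eq_iff:
  assumes "c \<in> carrier G" "r \<in> carrier G" "x \<in> carrier G"
  shows "inv c \<otimes> r \<otimes> c = x \<longleftrightarrow> r = c \<otimes> x \<otimes> inv c"
proof -
  have "c \<otimes> (inv c \<otimes> z) = z" "inv c \<otimes> (c \<otimes> z) = z" if "z \<in> carrier G" for z
    using assms(1) that by (simp_all add: m_assoc [symmetric])
  then show ?thesis using assms by (auto simp: m_assoc)
qed

text \<open>The \<open>j\<close>-th inversion of the alternating word \<open>s t s t \<dots>\<close>, counted from 0, is itself an
  alternating product of \<open>2 j + 1\<close> letters, hence equals \<open>(s t)\<^sup>j s\<close>.\<close>

lemma odd_inversion_alternating:
  assumes st: "s \<in> carrier G" "t \<in> carrier G" "s \<otimes> s = \<one>" "t \<otimes> t = \<one>"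
    and r: "r \<in> carrier G"
  shows "odd_inversion G (concat (replicate k [s, t])) r \<longleftrightarrow>
    odd (\<Sum>j<2 * k. of_bool (r = (s \<otimes> t) [^] j \<otimes> s) :: nat)"
  using r
proof (induction k arbitrary: r)
  case (Suc k)
  let ?c = "s \<otimes> t"
  have c: "?c \<in> carrier G" using st by simp
  have inv_eq: "inv s = s" "inv t = t" using st by (simp_all add: inv_equality)
  have conj: "inv t \<otimes> (inv s \<otimes> r \<otimes> s) \<otimes> t = inv ?c \<otimes> r \<otimes> ?c"
    using st Suc.prems by (simp add: inv_mult_group m_assoc)
  \<comment> \<open>Removing the first two letters \<open>s, t\<close> shifts the index of the remaining inversions by two.\<close>
  have shift: "inv ?c \<otimes> r \<otimes> ?c = ?c [^] j \<otimes> s \<longleftrightarrow> r = ?c [^] Suc (Suc j) \<otimes> s" for j :: nat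
  proof -
    have "inv ?c \<otimes> r \<otimes> ?c = ?c [^] j \<otimes> s \<longleftrightarrow> r = ?c \<otimes> (?c [^] j \<otimes> s) \<otimes> inv ?c"
      using c st(1) Suc.prems by (intro conjugate_eq_iff) auto
    also have "?c \<otimes> (?c [^] j \<otimes> s) \<otimes> inv ?c = (?c \<otimes> ?c [^] j) \<otimes> (s \<otimes> inv ?c)"
      using c st(1) by (simp add: m_assoc)
    also have "s \<otimes> inv ?c = ?c \<otimes> s"
      using st by (simp add: inv_mult_group inv_eq m_assoc)
    also have "(?c \<otimes> ?c [^] j) \<otimes> (?c \<otimes> s) = ?c [^] Suc (Suc j) \<otimes> s"
      unfolding nat_pow_Suc2[OF c, symmetric] using c st(1) by (simp add: m_assoc[of _ ?c s])
    finally show ?thesis .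
  qed
  have second: "inv s \<otimes> r \<otimes> s = t \<longleftrightarrow> r = ?c [^] Suc 0 \<otimes> s"
    using conjugate_eq_iff[of s r t] st Suc.prems by (simp add: inv_eq)
  have "odd_inversion G (concat (replicate (Suc k) [s, t])) r \<longleftrightarrow>
      (r = ?c [^] (0::nat) \<otimes> s) \<noteq> ((r = ?c [^] Suc 0 \<otimes> s) \<noteq>
        odd (\<Sum>j<2 * k. of_bool (r = ?c [^] Suc (Suc j) \<otimes> s) :: nat))"
    using Suc.IH[of "inv ?c \<otimes> r \<otimes> ?c"] c st Suc.prems
    by (simp add: conj second shift del: nat_pow_Suc)
  also have "\<dots> \<longleftrightarrow> odd (\<Sum>j<2 * Suc k. of_bool (r = ?c [^] j \<otimes> s) :: nat)"
    by (simp add: sum.lessThan_Suc_shift del: sum.lessThan_Suc nat_pow_Suc)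
  finally show ?case .
qed simp

text \<open>If \<open>(s t)\<^sup>k = 1\<close>, the sequence \<open>(s t)\<^sup>j s\<close> has period \<open>k\<close> in \<open>j\<close>, so the \<open>2 k\<close> inversions of the
  relator are a sequence of length \<open>k\<close> repeated twice.\<close>

lemma not_odd_inversion_relator:
  assumes st: "s \<in> carrier G" "t \<in> carrier G" "s \<otimes> s = \<one>" "t \<otimes> t = \<one>"
    and r: "r \<in> carrier G" and pow: "(s \<otimes> t) [^] (k :: nat) = \<one>"
  shows "\<not> odd_inversion G (concat (replicate k [s, t])) r"
proof -
  define p :: "nat \<Rightarrow> nat" where "p j = of_bool (r = (s \<otimes> t) [^] j \<otimes> s)" for j
  have periodic: "p (j + k) = p j" for j
    using st by (simp add: p_def nat_pow_mult [symmetric] pow)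
  have "(\<Sum>j<2 * k. p j) = (\<Sum>j<k. p j) + (\<Sum>j<k. p (j + k))"
    by (simp add: mult_2 lessThan_atLeast0 sum.atLeastLessThan_concat[of 0 k "k + k", symmetric]
        sum.shift_bounds_nat_ivl[of p 0 k k, symmetric])
  also have "\<dots> = 2 * (\<Sum>j<k. p j)" by (simp add: periodic)
  finally show ?thesis
    using odd_inversion_alternating[OF st r, of k] by (simp add: p_def)
qed

lemma list_mult_replicate_pair:
  assumes "s \<in> carrier G" "t \<in> carrier G"
  shows "list_mult G (concat (replicate k [s, t])) = (s \<otimes> t) [^] k"
proof (induction k)
  case (Suc k)
  then show ?case using assms nat_pow_Suc2[of "s \<otimes> t" k] by (simp add: m_assoc del: nat_pow_Suc)
qed simp

end

section \<open>Inversions in a Coxeter group\<close>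

lemma pres_eq_words_over:
  assumes "pres_eq S R u v" "R \<subseteq> words_over S"
  shows "u \<in> words_over S \<and> v \<in> words_over S"
  using assms by induction auto

locale coxeter =
  fixes W :: "('a, 'm) monoid_scheme" (structure) and S :: "'a set"
  assumes coxeter_system: "coxeter_system W S"
begin

sublocale group W
  using coxeter_system by (auto simp: coxeter_system_def presented_by_def)

lemma gen_in_carrier: "S \<subseteq> carrier W"
  using coxeter_system by (auto simp: coxeter_system_def presented_by_def)

lemma gen_square [simp]:
  assumes "s \<in> S"
  shows "s \<otimes> s = \<one>"
proof -
  obtain m where m: "coxeter_matrix S m" "presented_by W S (coxeter_relators S m)"
    using coxeter_system by (auto simp: coxeter_system_def)
  have "concat (replicate 1 [(s, True), (s, True)]) \<in> coxeter_relators S m"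
    using m(1) assms unfolding coxeter_relators_def coxeter_matrix_def
    by (intro CollectI exI[of _ s] exI[of _ "1::nat"]) (simp add: one_enat_def)
  then have "pres_eq S (coxeter_relators S m) [(s, True), (s, True)] []"
    by (intro pres_eq.relator) simp
  then have "word_eval W [(s, True), (s, True)] = word_eval W []"
    using m(2) assms by (simp add: presented_by_def)
  then show ?thesis using assms gen_in_carrier by (auto simp: word_eval_def)
qed

lemma gen_inv [simp]: "s \<in> S \<Longrightarrow> inv s = s"
  using gen_in_carrier by (intro inv_equality) auto

lemma gen_cancel_left [simp]: "s \<in> S \<Longrightarrow> x \<in> carrier W \<Longrightarrow> s \<otimes> (s \<otimes> x) = x"
  using gen_in_carrier by (metis gen_square l_one m_assoc subsetD)

text \<open>Generators are involutions, so a letter and its formal inverse have the same value, and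
  the signs in a word can be forgotten.\<close>

lemma word_eval_eq_list_mult:
  "u \<in> words_over S \<Longrightarrow> word_eval W u = list_mult W (map fst u)"
  unfolding word_eval_def by (rule arg_cong[of _ _ "list_mult W"]) auto

text \<open>No step of a derivation changes the parity: a cancelling pair has the inversion \<open>s\<close> twice,
  relators have even parity throughout, and for concatenation the cocycle identity applies
  because derivable words have equal products.\<close>

lemma odd_inversion_pres_eq:
  assumes pres: "presented_by W S (coxeter_relators S m)"
    and "pres_eq S (coxeter_relators S m) u v" and "t \<in> carrier W"
  shows "odd_inversion W (map fst u) t \<longleftrightarrow> odd_inversion W (map fst v) t"
  using assms(2,3)
proof (induction arbitrary: t)
  case (append u u' v v')
  have words: "u \<in> words_over S" "u' \<in> words_over S" "v \<in> words_over S" "v' \<in> words_over S"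
    using append.hyps[THEN pres_eq_words_over] pres by (auto simp: presented_by_def)
  then have carr: "set (map fst x) \<subseteq> carrier W" if "x \<in> {u, u', v, v'}" for x
    using that gen_in_carrier by fastforce
  have "word_eval W u = word_eval W u'"
    using append.hyps(1) pres words by (auto simp: presented_by_def)
  then have "list_mult W (map fst u) = list_mult W (map fst u')"
    by (simp add: word_eval_eq_list_mult words)
  then show ?case
    using append carr by (simp add: odd_inversion_append)
next
  case (cancel s b)
  then have "inv s \<otimes> t \<otimes> s = s \<longleftrightarrow> t = s"
    using conjugate_eq_iff[of s t s] gen_in_carrier by (auto simp: m_assoc)
  then show ?case by (auto simp del: gen_inv)
next
  case (relator r)
  then obtain s t' k where r: "r = concat (replicate k [(s, True), (t', True)])"
    and st: "s \<in> S" "t' \<in> S"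
    by (auto simp: coxeter_relators_def)
  have letters: "map fst r = concat (replicate k [s, t'])"
    by (simp add: r map_concat)
  have "r \<in> words_over S" using relator pres by (auto simp: presented_by_def)
  moreover have "word_eval W r = word_eval W []"
    using relator pres \<open>r \<in> words_over S\<close> pres_eq.relator[OF relator(1)]
    by (simp add: presented_by_def)
  ultimately have "list_mult W (concat (replicate k [s, t'])) = \<one>"
    using word_eval_eq_list_mult[of r] by (simp add: letters) (simp add: word_eval_def)
  then have "(s \<otimes> t') [^] k = \<one>"
    using st gen_in_carrier list_mult_replicate_pair[of s t' k] by (metis subsetD)
  then show ?case
    using not_odd_inversion_relator[of s t' t k] st gen_in_carrier relator.prems
    by (auto simp: letters)
qed auto

text \<open>Here it matters that the Coxeter relators generate all relations among the generators: words
  with equal products are joined by a derivation.\<close>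

lemma odd_inversion_cong:
  assumes "set xs \<subseteq> S" "set ys \<subseteq> S" "list_mult W xs = list_mult W ys" "t \<in> carrier W"
  shows "odd_inversion W xs t \<longleftrightarrow> odd_inversion W ys t"
proof -
  obtain m where pres: "presented_by W S (coxeter_relators S m)"
    using coxeter_system by (auto simp: coxeter_system_def)
  define lift :: "'a list \<Rightarrow> 'a gword" where "lift = map (\<lambda>s. (s, True))"
  have fst_lift: "map fst (lift zs) = zs" for zs by (simp add: lift_def comp_def)
  have words: "lift xs \<in> words_over S" "lift ys \<in> words_over S"
    using assms(1,2) by (auto simp: lift_def)
  then have "word_eval W (lift xs) = word_eval W (lift ys)"
    using assms(3) by (simp add: word_eval_eq_list_mult fst_lift)
  then have "pres_eq S (coxeter_relators S m) (lift xs) (lift ys)"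
    using pres words unfolding presented_by_def by blast
  from odd_inversion_pres_eq[OF pres this assms(4)] show ?thesis by (simp add: fst_lift)
qed

section \<open>The exchange property for subexpressions\<close>

text \<open>Dropping the letters with exponent 0, rather than keeping them as factors \<open>\<one>\<close>, leaves a word
  in the generators, to which parity invariance applies.\<close>

definition chosen :: "'a list \<Rightarrow> nat list \<Rightarrow> 'a list" where
  "chosen ss e = map fst (filter (\<lambda>(s, k). k = 1) (zip ss e))"

lemma chosen_Nil [simp]: "chosen [] e = []"
  and chosen_Cons [simp]: "chosen (s # ss) (k # e) = (if k = 1 then s # chosen ss e else chosen ss e)"
  by (simp_all add: chosen_def)

lemma set_chosen: "set (chosen ss e) \<subseteq> set ss"
  by (auto simp: chosen_def dest: set_zip_leftD)

lemma subexpressions_Nil: "subexpressions W [] w = (if w = \<one> then {[]} else {})"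
  by (auto simp: subexpressions_def)

text \<open>Since \<open>s\<close> is an involution, choosing the first letter leaves the target \<open>s w\<close> for the rest.\<close>

lemma subexpressions_Cons:
  assumes "s \<in> S" "set ss \<subseteq> S" "w \<in> carrier W"
  shows "subexpressions W (s # ss) w =
    (#) 0 ` subexpressions W ss w \<union> (#) 1 ` subexpressions W ss (s \<otimes> w)"
proof -
  have s: "s \<in> carrier W" using assms gen_in_carrier by auto
  have closed: "list_mult W (map2 (\<lambda>s k. s [^] k) ss e) \<in> carrier W" for e :: "nat list"
    using assms gen_in_carrier by (intro list_mult_closed) (auto dest!: set_zip_leftD)
  have swap: "s \<otimes> x = w \<longleftrightarrow> x = s \<otimes> w" if "x \<in> carrier W" for x
    using that assms gen_cancel_left[of s] by metis
  have "e \<in> subexpressions W (s # ss) w \<longleftrightarrow>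
      e \<in> (#) 0 ` subexpressions W ss w \<union> (#) 1 ` subexpressions W ss (s \<otimes> w)" for e
  proof (cases e)
    case Nil
    then show ?thesis by (auto simp: subexpressions_def)
  next
    case (Cons k e')
    have "0 # e' \<in> subexpressions W (s # ss) w \<longleftrightarrow> e' \<in> subexpressions W ss w"
      by (simp add: subexpressions_def closed)
    moreover have "1 # e' \<in> subexpressions W (s # ss) w \<longleftrightarrow> e' \<in> subexpressions W ss (s \<otimes> w)"
      by (simp add: subexpressions_def closed s swap)
    moreover have "k = 0 \<or> k = 1" if "k # e' \<in> subexpressions W (s # ss) w"
      using that by (auto simp: subexpressions_def)
    ultimately show ?thesis using Cons by auto
  qed
  then show ?thesis by blast
qed

lemma list_mult_chosen:
  assumes "set ss \<subseteq> S" "w \<in> carrier W" "e \<in> subexpressions W ss w"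
  shows "list_mult W (chosen ss e) = w"
  using assms
proof (induction ss arbitrary: e w)
  case Nil
  then show ?case by (simp add: subexpressions_Nil split: if_splits)
next
  case (Cons s ss)
  then have s: "s \<in> S" "s \<in> carrier W" using gen_in_carrier by auto
  then show ?case
    using Cons.IH[of w] Cons.IH[of "s \<otimes> w"] Cons.prems by (auto simp: subexpressions_Cons)
qed

end

lemma hamming_dist_Nil [simp]: "hamming_dist [] f = 0"
  by (simp add: hamming_dist_def)

lemma hamming_dist_refl [simp]: "hamming_dist e e = 0"
  by (simp add: hamming_dist_def)

lemma hamming_dist_Cons [simp]:
  "hamming_dist (a # e) (b # f) = of_bool (a \<noteq> b) + hamming_dist e f"
proof -
  have "{i. i < length (a # e) \<and> (a # e) ! i \<noteq> (b # f) ! i} =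
      (if a \<noteq> b then {0} else {}) \<union> Suc ` {i. i < length e \<and> e ! i \<noteq> f ! i}"
    by (auto simp: less_Suc_eq_0_disj)
  then show ?thesis
    by (simp add: hamming_dist_def card_image)
qed

lemma hamming_dist_commute: "length e = length f \<Longrightarrow> hamming_dist e f = hamming_dist f e"
  by (simp add: hamming_dist_def eq_commute)

context coxeter
begin

text \<open>An odd number of occurrences is at least one occurrence, so \<open>t\<close> is an inversion of the chosen
  word; setting the entry of the corresponding letter to 0 multiplies the target by \<open>t\<close>.\<close>

lemma subexpression_exchange:
  assumes "set ss \<subseteq> S" "w \<in> carrier W" "t \<in> carrier W"
    and "e \<in> subexpressions W ss w" "odd_inversion W (chosen ss e) t"
  shows "\<exists>f \<in> subexpressions W ss (t \<otimes> w). hamming_dist e f = 1"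
  using assms
proof (induction ss arbitrary: e w t)
  case (Cons s ss)
  then have s: "s \<in> S" "s \<in> carrier W" "set ss \<subseteq> S" using gen_in_carrier by auto
  note expand = subexpressions_Cons[OF s(1,3)]
  from Cons.prems(4) consider
      e' where "e = 0 # e'" "e' \<in> subexpressions W ss w"
    | e' where "e = 1 # e'" "e' \<in> subexpressions W ss (s \<otimes> w)"
    using Cons.prems(2) by (auto simp: expand)
  then show ?case
  proof cases
    case (1 e')
    then obtain f where "f \<in> subexpressions W ss (t \<otimes> w)" "hamming_dist e' f = 1"
      using Cons.IH[of w t e'] Cons.prems s by auto
    then show ?thesis using 1 Cons.prems by (intro bexI[of _ "0 # f"]) (auto simp: expand)
  next
    case (2 e')
    show ?thesis
    proof (cases "t = s")
      case True
      then show ?thesis using 2 s Cons.prems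
        by (intro bexI[of _ "0 # e'"]) (auto simp: expand)
    next
      case False
      then have "odd_inversion W (chosen ss e') (s \<otimes> t \<otimes> s)"
        using 2 Cons.prems s by simp
      then obtain f where f: "f \<in> subexpressions W ss ((s \<otimes> t \<otimes> s) \<otimes> (s \<otimes> w))"
          "hamming_dist e' f = 1"
        using Cons.IH[of "s \<otimes> w" "s \<otimes> t \<otimes> s" e'] Cons.prems s 2 by auto
      have "(s \<otimes> t \<otimes> s) \<otimes> (s \<otimes> w) = s \<otimes> (t \<otimes> w)"
        using s Cons.prems by (simp add: m_assoc)
      then show ?thesis using f 2 s Cons.prems
        by (intro bexI[of _ "1 # f"]) (auto simp: expand)
    qed
  qed
qed simp

text \<open>Parity decides from which side the exchange works: either the given subexpression
  with target \<open>w\<close> has odd parity at \<open>s\<close>, or else every word for \<open>s w\<close> does.\<close>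

lemma subexpressions_adjacent_targets:
  assumes s: "s \<in> S" and ss: "set ss \<subseteq> S" and w: "w \<in> carrier W"
    and "e \<in> subexpressions W ss w" "f \<in> subexpressions W ss (s \<otimes> w)"
  shows "\<exists>e' \<in> subexpressions W ss w. \<exists>f' \<in> subexpressions W ss (s \<otimes> w). hamming_dist e' f' = 1"
proof (cases "odd_inversion W (chosen ss e) s")
  case True
  then show ?thesis using subexpression_exchange[of ss w s e] assms gen_in_carrier by blast
next
  case False
  have sc: "s \<in> carrier W" using s gen_in_carrier by auto
  have subset: "set (chosen ss e) \<subseteq> S" "set (chosen ss f) \<subseteq> S"
    using ss set_chosen[of ss] by blast+
  \<comment> \<open>Prefixing \<open>s\<close> adds the inversion \<open>s\<close> and conjugates the others by \<open>s\<close>, which fixes \<open>s\<close>.\<close>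
  have "odd_inversion W (s # chosen ss e) s" using False s sc by simp
  moreover have "list_mult W (s # chosen ss e) = list_mult W (chosen ss f)"
    using list_mult_chosen[of ss w e] list_mult_chosen[of ss "s \<otimes> w" f] assms sc by simp
  ultimately have "odd_inversion W (chosen ss f) s"
    using odd_inversion_cong[of "s # chosen ss e" "chosen ss f" s] s subset sc by simp
  then obtain e' where e': "e' \<in> subexpressions W ss (s \<otimes> (s \<otimes> w))" "hamming_dist f e' = 1"
    using subexpression_exchange[of ss "s \<otimes> w" s f] assms sc by auto
  have "e' \<in> subexpressions W ss w" using e'(1) s w by simp
  moreover have "hamming_dist e' f = 1"
    using e' assms(5) hamming_dist_commute[of f e'] by (simp add: subexpressions_def)
  ultimately show ?thesis using assms(5) by blast
qed

section \<open>Connectedness\<close>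

abbreviation linked :: "'a list \<Rightarrow> 'a \<Rightarrow> nat list \<Rightarrow> nat list \<Rightarrow> bool" where
  "linked ss w e f \<equiv> e \<rightarrow>\<^sup>*\<^bsub>with_proj (subexpression_graph W ss w)\<^esub> f"

lemma arcs_subexpression_graph:
  "(e, f) \<in> parcs (subexpression_graph W ss w) \<longleftrightarrow>
    e \<in> subexpressions W ss w \<and> f \<in> subexpressions W ss w \<and> hamming_dist e f = 2"
  by (simp add: subexpression_graph_def)

lemma verts_subexpression_graph: "pverts (subexpression_graph W ss w) = subexpressions W ss w"
  by (simp add: subexpression_graph_def)

lemma linked_Cons:
  assumes "linked ss v e f"
    and sub: "(#) b ` subexpressions W ss v \<subseteq> subexpressions W (s # ss) w"
  shows "linked (s # ss) w (b # e) (b # f)"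
proof -
  interpret H: pair_graph "subexpression_graph W ss v" by (rule pair_graph_subexpression_graph)
  interpret K: pair_graph "subexpression_graph W (s # ss) w" by (rule pair_graph_subexpression_graph)
  from assms(1) show ?thesis
  proof (induction rule: H.reachable_induct)
    case base
    then show ?case using sub by (auto simp: verts_subexpression_graph)
  next
    case (step f g)
    then have "(b # f, b # g) \<in> parcs (subexpression_graph W (s # ss) w)"
      using sub by (auto simp: arcs_subexpression_graph)
    with step.IH show ?case by (rule K.reachable_adj_trans)
  qed
qed

lemma all_linked:
  assumes "set ss \<subseteq> S" "w \<in> carrier W"
    and "e \<in> subexpressions W ss w" "f \<in> subexpressions W ss w"
  shows "linked ss w e f"
  using assms
proof (induction ss arbitrary: w e f)
  case Nil
  interpret K: pair_graph "subexpression_graph W [] w" by (rule pair_graph_subexpression_graph)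
  have "e = f" using Nil by (auto simp: subexpressions_Nil split: if_splits)
  moreover have "e \<in> pverts (subexpression_graph W [] w)"
    using Nil by (simp only: verts_subexpression_graph)
  ultimately show ?case by simp
next
  case (Cons s ss)
  interpret K: pair_graph "subexpression_graph W (s # ss) w" by (rule pair_graph_subexpression_graph)
  have s: "s \<in> S" "s \<in> carrier W" "set ss \<subseteq> S" using Cons gen_in_carrier by auto
  let ?A = "subexpressions W ss w" and ?B = "subexpressions W ss (s \<otimes> w)"
  note expand = subexpressions_Cons[OF s(1,3) Cons.prems(2)]
  have zero: "linked (s # ss) w (0 # e) (0 # f)" if "e \<in> ?A" "f \<in> ?A" for e f
    using that Cons s by (intro linked_Cons[of ss w]) (auto simp: expand)
  have one: "linked (s # ss) w (1 # e) (1 # f)" if "e \<in> ?B" "f \<in> ?B" for e f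
    using that Cons s by (intro linked_Cons[of ss "s \<otimes> w"]) (auto simp: expand)
  have cross: "linked (s # ss) w (0 # e) (1 # f)" if ef: "e \<in> ?A" "f \<in> ?B" for e f
  proof -
    obtain e' f' where near: "e' \<in> ?A" "f' \<in> ?B" "hamming_dist e' f' = 1"
      using subexpressions_adjacent_targets[OF s(1,3) Cons.prems(2) ef] by blast
    then have "(0 # e', 1 # f') \<in> parcs (subexpression_graph W (s # ss) w)"
      by (auto simp: arcs_subexpression_graph expand)
    from K.reachable_trans[OF K.reachable_adj_trans[OF zero[OF ef(1) near(1)] this]
        one[OF near(2) ef(2)]]
    show ?thesis .
  qed
  have cross_back: "linked (s # ss) w (1 # f) (0 # e)" if "e \<in> ?A" "f \<in> ?B" for e f
    by (rule symmetric_reachable[OF K.sym_arcs cross[OF that]])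
  have "e \<in> (#) 0 ` ?A \<union> (#) 1 ` ?B" "f \<in> (#) 0 ` ?A \<union> (#) 1 ` ?B"
    using Cons.prems(3,4) unfolding expand .
  then show ?case by (elim UnE imageE) (simp_all only: zero one cross cross_back)
qed

end

theorem theorem1:
  fixes W :: "('a, 'm) monoid_scheme" and S :: "'a set" and ss :: "'a list" and w :: 'a
  assumes "coxeter_system W S"
    and "set ss \<subseteq> S"
    and "w \<in> carrier W"
  shows "verts (subexpression_graph W ss w) = {} \<or> connected (subexpression_graph W ss w)"
proof -
  interpret coxeter W S by unfold_locales (fact assms(1))
  interpret K: pair_graph "subexpression_graph W ss w" by (rule pair_graph_subexpression_graph)
  have "connected (subexpression_graph W ss w)" if "verts (subexpression_graph W ss w) \<noteq> {}"
    unfolding connected_def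
  proof (rule strongly_connectedI)
    fix e f
    assume "e \<in> verts (mk_symmetric (subexpression_graph W ss w))"
      "f \<in> verts (mk_symmetric (subexpression_graph W ss w))"
    then have "linked ss w e f"
      using all_linked[OF assms(2,3)] by (simp add: verts_subexpression_graph)
    then show "e \<rightarrow>\<^sup>*\<^bsub>with_proj (mk_symmetric (subexpression_graph W ss w))\<^esub> f"
      by (rule K.reachable_mk_symmetricI)
  qed (use that in simp)
  then show ?thesis by blast
qed

end
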